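(* Let $H_1$ and $H_2$ be vertex-disjoint finite connected simple hairy graphs with $\gamma(H_1)\geq 2$ and $\gamma(H_2)\geq 2$, let $u$ be a support vertex of $H_1$ and $v$ a support vertex of $H_2$, and let $t\geq 1$ be an integer. Let $G_t(H_1,H_2)$ be the graph with vertex set $V(H_1)\cup V(H_2)\cup\{x_1,x_2,\dots,x_t\}$, where $x_1,\dots,x_t$ are $t$ distinct new vertices, and edge set $E(H_1)\cup E(H_2)\cup\{ux_1,x_1x_2,\dots,x_{t-1}x_t,x_tv\}$. If $t=1$ or $t\equiv 0\pmod 3$, then $G_t(H_1,H_2)$ is an SR-graph.
   Context: $\gamma(G)$ denotes the domination number of a finite simple graph $G$. For an edge $e=ab$ of $G$, $G-e$ is the graph obtained by deleting $e$, and $G_e$ is the graph obtained by subdividing $e$: delete $e$, add a new vertex $w$ and the edges $aw$ and $wb$. A finite connected simple graph $G$ of order at least two is an SR-graph (sub-removable graph) if $\gamma(G-e)=\gamma(G_e)$ for every edge $e$ of $G$. A leaf is a vertex of degree $1$; a support vertex is a vertex adjacent to a leaf. A graph is a hairy graph if each of its vertices is a leaf or a support vertex. *)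

theory Defs
  imports "Graph_Theory.Graph_Theory"
begin

(* A finite simple graph is a pair_graph: a finite, loop-free, symmetric relation on a vertex
   set.  An edge ab is the pair of opposite arcs (a, b), (b, a). *)

definition dominating_set :: "'a pair_pre_digraph \<Rightarrow> 'a set \<Rightarrow> bool" where
  "dominating_set G D \<longleftrightarrow>
     D \<subseteq> pverts G \<and> (\<forall>v \<in> pverts G - D. \<exists>d \<in> D. (d, v) \<in> parcs G)"

definition domination_number :: "'a pair_pre_digraph \<Rightarrow> nat" where
  "domination_number G = Min (card ` {D. dominating_set G D})"

definition delete_edge :: "'a pair_pre_digraph \<Rightarrow> 'a \<times> 'a \<Rightarrow> 'a pair_pre_digraph" where
  "delete_edge G e = G\<lparr>parcs := parcs G - {(fst e, snd e), (snd e, fst e)}\<rparr>"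

definition rename_verts :: "('a \<Rightarrow> 'b) \<Rightarrow> 'a pair_pre_digraph \<Rightarrow> 'b pair_pre_digraph" where
  "rename_verts f G = \<lparr>pverts = f ` pverts G, parcs = map_prod f f ` parcs G\<rparr>"

(* The new vertex is None; the old vertices are renamed by Some, so that a new vertex exists
   even if G uses up its vertex type. *)
definition subdivide_edge :: "'a pair_pre_digraph \<Rightarrow> 'a \<times> 'a \<Rightarrow> 'a option pair_pre_digraph" where
  "subdivide_edge G e = subdivide (rename_verts Some G) (map_prod Some Some e) None"

definition SR_graph :: "'a pair_pre_digraph \<Rightarrow> bool" where
  "SR_graph G \<longleftrightarrow>
     pair_graph G \<and> Digraph_Component.connected (with_proj G) \<and> card (pverts G) \<ge> 2 \<and>
     (\<forall>e \<in> parcs G. domination_number (delete_edge G e) = domination_number (subdivide_edge G e))"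

(* In a symmetric loop-free digraph the out-degree is the degree of the undirected graph. *)
definition leaf :: "'a pair_pre_digraph \<Rightarrow> 'a \<Rightarrow> bool" where
  "leaf G v \<longleftrightarrow> v \<in> pverts G \<and> out_degree (with_proj G) v = 1"

definition support_vertex :: "'a pair_pre_digraph \<Rightarrow> 'a \<Rightarrow> bool" where
  "support_vertex G v \<longleftrightarrow> v \<in> pverts G \<and> (\<exists>l. leaf G l \<and> (v, l) \<in> parcs G)"

definition hairy :: "'a pair_pre_digraph \<Rightarrow> bool" where
  "hairy G \<longleftrightarrow> (\<forall>v \<in> pverts G. leaf G v \<or> support_vertex G v)"

definition path_join ::
  "'a pair_pre_digraph \<Rightarrow> 'a \<Rightarrow> 'a pair_pre_digraph \<Rightarrow> 'a \<Rightarrow> nat \<Rightarrow> (nat \<Rightarrow> 'a) \<Rightarrow> 'a pair_pre_digraph"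
  where
  "path_join H1 u H2 v t x = \<lparr>
     pverts = pverts H1 \<union> pverts H2 \<union> x ` {1..t},
     parcs = parcs H1 \<union> parcs H2 \<union>
       ({(u, x 1)} \<union> {(x i, x (i + 1)) |i. 1 \<le> i \<and> i < t} \<union> {(x t, v)})\<^sup>s\<rparr>"

end

theory Submission
  imports Defs "HOL-Library.Disjoint_Sets"
begin

text \<open>
  A set \<open>P\<close> of vertices with pairwise disjoint closed neighbourhoods bounds the size of every
  dominating set from below. In \<open>G\<^sub>t(H\<^sub>1, H\<^sub>2)\<close>, one leaf per support vertex together with the
  path vertices \<open>x\<^sub>n\<close>, \<open>n \<equiv> 2 (mod 3)\<close>, is such a set, and it remains one when an edge is deleted or
  subdivided. So for each edge \<open>e = ab\<close> it is enough to find a set \<open>D\<close> of the same size that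
  dominates \<open>G - e\<close> and contains \<open>a\<close> or \<open>b\<close>: it then also dominates \<open>G\<^sub>e\<close>, and both domination
  numbers are \<open>|D|\<close>. Take all support vertices and suitable \<open>\<lfloor>t/3\<rfloor>\<close> path vertices; if \<open>e = sl\<close>
  where \<open>l\<close> is the only leaf at \<open>s\<close>, replace \<open>s\<close> by \<open>l\<close>, which works because \<open>s\<close> is adjacent to another
  support vertex. If \<open>s\<close> has several leaves, add \<open>l\<close> both to \<open>D\<close> and to \<open>P\<close>.
\<close>

section \<open>Domination and packings\<close>

text \<open>In-neighbours are taken because \<open>dominating_set\<close> looks for an arc from the
  dominator; in a symmetric graph this is the usual closed neighbourhood.\<close>

definition closed_nbhd :: "'a pair_pre_digraph \<Rightarrow> 'a \<Rightarrow> 'a set" where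
  "closed_nbhd G p = insert p {z. (z, p) \<in> parcs G}"

definition packing :: "'a pair_pre_digraph \<Rightarrow> 'a set \<Rightarrow> bool" where
  "packing G P \<longleftrightarrow> P \<subseteq> pverts G \<and> disjoint_family_on (closed_nbhd G) P"

text \<open>Each closed neighbourhood of a vertex of \<open>P\<close> meets \<open>D\<close>; by
  disjointness, choosing a point of \<open>D\<close> in each is injective.\<close>

lemma packing_card_le:
  assumes "finite (pverts G)" "packing G P" "dominating_set G D"
  shows "card P \<le> card D"
proof -
  have "\<exists>d\<in>D. d \<in> closed_nbhd G p" if "p \<in> P" for p
    using that assms unfolding packing_def dominating_set_def closed_nbhd_def by blast
  then obtain g where g: "\<And>p. p \<in> P \<Longrightarrow> g p \<in> D \<and> g p \<in> closed_nbhd G p"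
    by metis
  have "inj_on g P"
    using assms(2) g unfolding packing_def disjoint_family_on_def inj_on_def
    by (metis disjoint_iff)
  moreover have "g ` P \<subseteq> D" using g by blast
  moreover have "finite D"
    using assms finite_subset unfolding dominating_set_def by blast
  ultimately show ?thesis by (metis card_inj_on_le)
qed

lemma finite_dominating_sets:
  "finite (pverts G) \<Longrightarrow> finite {D. dominating_set G D}"
  by (rule finite_subset[of _ "Pow (pverts G)"]) (auto simp: dominating_set_def)

lemma domination_number_le:
  assumes "finite (pverts G)" "dominating_set G D"
  shows "domination_number G \<le> card D"
  unfolding domination_number_def using assms finite_dominating_sets[of G] by (intro Min_le) auto

text \<open>A dominating set and a packing of equal size certify each other's optimality.\<close>

lemma domination_number_eqI:
  assumes "finite (pverts G)" "dominating_set G D" "packing G P" "card D = card P"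
  shows "domination_number G = card D"
  unfolding domination_number_def
proof (rule Min_eqI)
  show "finite (card ` {D. dominating_set G D})" using assms finite_dominating_sets by blast
  show "card D \<in> card ` {D. dominating_set G D}" using assms by blast
  show "card D \<le> k" if "k \<in> card ` {D. dominating_set G D}" for k
    using that assms packing_card_le by fastforce
qed

section \<open>Deleting and subdividing an edge\<close>

lemma pverts_delete_edge [simp]: "pverts (delete_edge G e) = pverts G"
  by (simp add: delete_edge_def)

lemma parcs_delete_edge [simp]: "parcs (delete_edge G (a, b)) = parcs G - {(a, b), (b, a)}"
  by (simp add: delete_edge_def)

lemma pverts_subdivide_edge [simp]: "pverts (subdivide_edge G e) = insert None (Some ` pverts G)"
  by (simp add: subdivide_edge_def rename_verts_def)

lemma parcs_subdivide_edge:
  "parcs (subdivide_edge G (a, b)) =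
     map_prod Some Some ` parcs (delete_edge G (a, b)) \<union>
     {(Some a, None), (None, Some a), (None, Some b), (Some b, None)}"
  by (auto simp: subdivide_edge_def rename_verts_def)

lemma delete_edge_commute: "delete_edge G (a, b) = delete_edge G (b, a)"
  by (simp add: delete_edge_def insert_commute)

lemma subdivide_edge_commute: "subdivide_edge G (a, b) = subdivide_edge G (b, a)"
  by (rule pair_pre_digraph.equality)
    (auto simp: parcs_subdivide_edge delete_edge_commute[of G a b])

text \<open>The new vertex lies only in the closed neighbourhoods of \<open>a\<close> and \<open>b\<close>, so \<open>P\<close> remains a packing
  when it does not contain both; and it is dominated as soon as \<open>D\<close> contains one of them.\<close>

lemma delete_subdivide_domination_eqI:
  assumes "finite (pverts G)"
    and D: "dominating_set (delete_edge G (a, b)) D" "a \<in> D \<or> b \<in> D"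
    and P: "packing (delete_edge G (a, b)) P" "\<not> (a \<in> P \<and> b \<in> P)"
    and "card D = card P"
  shows "domination_number (delete_edge G (a, b)) = domination_number (subdivide_edge G (a, b))"
proof -
  have "domination_number (delete_edge G (a, b)) = card D"
    using assms by (intro domination_number_eqI) auto
  moreover have "domination_number (subdivide_edge G (a, b)) = card (Some ` D)"
  proof (rule domination_number_eqI)
    show "finite (pverts (subdivide_edge G (a, b)))" using assms by simp
    show "dominating_set (subdivide_edge G (a, b)) (Some ` D)"
      unfolding dominating_set_def
    proof (intro conjI ballI)
      show "Some ` D \<subseteq> pverts (subdivide_edge G (a, b))"
        using D by (auto simp: dominating_set_def)
      fix w assume w: "w \<in> pverts (subdivide_edge G (a, b)) - Some ` D"
      show "\<exists>d\<in>Some ` D. (d, w) \<in> parcs (subdivide_edge G (a, b))"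
      proof (cases w)
        case None
        then show ?thesis using D(2) by (auto simp: parcs_subdivide_edge)
      next
        case (Some q)
        then have "q \<in> pverts (delete_edge G (a, b)) - D" using w by auto
        moreover have "\<forall>q\<in>pverts (delete_edge G (a, b)) - D. \<exists>d\<in>D. (d, q) \<in> parcs (delete_edge G (a, b))"
          using D(1) unfolding dominating_set_def by (rule conjunct2)
        ultimately obtain d where "d \<in> D" "(d, q) \<in> parcs (delete_edge G (a, b))" by blast
        moreover from this have "(Some d, Some q) \<in> parcs (subdivide_edge G (a, b))"
          unfolding parcs_subdivide_edge by (intro UnI1 image_eqI[of _ _ "(d, q)"]) simp_all
        ultimately show ?thesis using Some by blast
      qed
    qed
    have nbhd: "closed_nbhd (subdivide_edge G (a, b)) (Some p) \<subseteq>
        Some ` closed_nbhd (delete_edge G (a, b)) p \<union> (if p = a \<or> p = b then {None} else {})" for p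
      unfolding closed_nbhd_def parcs_subdivide_edge by auto
    show "packing (subdivide_edge G (a, b)) (Some ` P)"
      unfolding packing_def disjoint_family_on_def
    proof (intro conjI ballI impI)
      show "Some ` P \<subseteq> pverts (subdivide_edge G (a, b))"
        using P by (auto simp: packing_def)
      fix m n assume mn: "m \<in> Some ` P" "n \<in> Some ` P" "m \<noteq> n"
      then obtain p q where pq: "m = Some p" "n = Some q" "p \<in> P" "q \<in> P" "p \<noteq> q" by blast
      then have "closed_nbhd (delete_edge G (a, b)) p \<inter> closed_nbhd (delete_edge G (a, b)) q = {}"
        using P(1) by (auto simp: packing_def disjoint_family_on_def)
      moreover have "\<not> ((p = a \<or> p = b) \<and> (q = a \<or> q = b))" using pq P(2) by blast
      ultimately show "closed_nbhd (subdivide_edge G (a, b)) m \<inter>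
          closed_nbhd (subdivide_edge G (a, b)) n = {}"
        using nbhd[of p] nbhd[of q] unfolding pq(1,2) by (auto split: if_splits)
    qed
    show "card (Some ` D) = card (Some ` P)" using assms by (simp add: card_image)
  qed
  ultimately show ?thesis by (simp add: card_image)
qed

lemma packing_delete_edge:
  assumes "packing G P"
  shows "packing (delete_edge G (a, b)) P"
proof -
  have "closed_nbhd (delete_edge G (a, b)) p \<subseteq> closed_nbhd G p" for p
    by (auto simp: closed_nbhd_def)
  then show ?thesis using assms by (fastforce simp: packing_def disjoint_family_on_def)
qed

text \<open>Otherwise \<open>a\<close> would lie in two of the disjoint closed neighbourhoods. This
  supplies the side condition on \<open>P\<close> in
  \<open>delete_subdivide_domination_eqI\<close>.\<close>

lemma packing_not_adjacent:
  assumes "packing G P" "(a, b) \<in> parcs G" "a \<noteq> b"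
  shows "\<not> (a \<in> P \<and> b \<in> P)"
  using assms by (auto simp: packing_def disjoint_family_on_def closed_nbhd_def)

text \<open>An isolated vertex is its own closed neighbourhood and lies in no other. Deleting the
  edge at a leaf produces such a vertex.\<close>

lemma packing_insert_isolated:
  assumes "packing G P" "l \<in> pverts G" "\<And>z. (z, l) \<notin> parcs G" "\<And>z. (l, z) \<notin> parcs G"
  shows "packing G (insert l P)"
proof -
  have "closed_nbhd G l = {l}" using assms by (auto simp: closed_nbhd_def)
  moreover have "l \<notin> closed_nbhd G p" if "p \<noteq> l" for p
    using that assms by (auto simp: closed_nbhd_def)
  ultimately show ?thesis
    using assms(1,2) by (auto simp: packing_def disjoint_family_on_def)
qed

section \<open>Dominating a path with domination at both ends\<close>

text \<open>Positions \<open>0\<close> and \<open>t + 1\<close> are the ends, \<open>C\<close> is the set of centres, and the link between \<open>i\<close> and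
  \<open>i + 1\<close> is cut. Up to the cut the centres are the multiples of 3, so that \<open>0\<close> serves the start;
  one centre sits next to the cut, and beyond it \<open>t + 1\<close> serves the end.\<close>

definition path_centres :: "nat \<Rightarrow> nat \<Rightarrow> nat set \<Rightarrow> bool" where
  "path_centres t i C \<longleftrightarrow> C \<subseteq> {1..t} \<and> card C = t div 3 \<and>
    (i \<in> insert 0 (insert (t + 1) C) \<or> i + 1 \<in> insert 0 (insert (t + 1) C)) \<and>
    (\<forall>n\<in>{1..t} - C. \<exists>c\<in>insert 0 (insert (t + 1) C). (c + 1 = n \<and> c \<noteq> i) \<or> (c = n + 1 \<and> n \<noteq> i))"

lemma ex_path_centres:
  fixes t i :: nat
  assumes t: "t = 1 \<or> t mod 3 = 0" and i: "i \<le> t"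
  shows "\<exists>C. path_centres t i C"
proof (cases "t = 1")
  case True
  \<comment> \<open>No centre is available; position 1 is served by whichever end is still linked to
    it.\<close>
  then have "path_centres t i {}" using i by (auto simp: path_centres_def)
  then show ?thesis by blast
next
  case False
  define m where "m = t div 3"
  define j where "j = i div 3"
  have t3: "t = 3 * m" using t False by (auto simp: m_def)
  have ij: "i = 3 * j \<or> i = 3 * j + 1 \<or> i = 3 * j + 2"
    using mult_div_mod_eq[of 3 i] mod_less_divisor[of 3 i] unfolding j_def by linarith
  \<comment> \<open>One centre per block \<open>3 * r + 1\<close>, \<open>3 * r + 2\<close>,
    \<open>3 * r + 3\<close>: the last position before block \<open>j\<close>, the middle one in
    block \<open>j\<close>, the first one after it.\<close>
  define f where "f r = (if r < j then 3 * r + 3 else if r = j then 3 * r + 2 else 3 * r + 1)" for r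
  define C where "C = f ` {..<m}"
  have inj: "inj_on f {..<m}"
    by (intro strict_mono_imp_inj_on strict_monoI) (auto simp: f_def)
  have memI: "f r \<in> C" if "r < m" for r using that by (auto simp: C_def)
  have low: "3 * r \<in> C" if "1 \<le> r" "r \<le> j" "r \<le> m" for r
  proof -
    have "f (r - 1) = 3 * r" using that by (cases r) (auto simp: f_def)
    then show ?thesis using memI[of "r - 1"] that by simp
  qed
  have mid: "3 * j + 2 \<in> C" if "j < m" using memI[of j] that by (auto simp: f_def)
  have high: "3 * r + 1 \<in> C" if "j < r" "r < m" for r using memI[of r] that by (auto simp: f_def)
  have jm: "j \<le> m" using i t3 by (simp add: j_def)
  let ?E = "insert 0 (insert (t + 1) C)"
  have "path_centres t i C"
    unfolding path_centres_def
  proof (intro conjI ballI)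
    show "C \<subseteq> {1..t}" by (auto simp: C_def f_def t3)
    show "card C = t div 3" using inj by (simp add: C_def card_image m_def)
    show "i \<in> ?E \<or> i + 1 \<in> ?E"
    proof (cases "i = 3 * j")
      case True
      then show ?thesis using low[of j] jm by (cases "j = 0") auto
    next
      case False
      then have "j < m" using ij i t3 by linarith
      then show ?thesis using False ij mid by auto
    qed
    fix n assume n: "n \<in> {1..t} - C"
    define q where "q = n div 3"
    have nq: "n = 3 * q \<or> n = 3 * q + 1 \<or> n = 3 * q + 2"
      using mult_div_mod_eq[of 3 n] mod_less_divisor[of 3 n] unfolding q_def by linarith
    \<comment> \<open>The ends prolong the two families of centres by one member each:
      \<open>0 = 3 * 0\<close> and \<open>t + 1 = 3 * m + 1\<close>.\<close>
    have lowE: "3 * r \<in> ?E" if "r \<le> j" for r using low[of r] that jm by (cases "r = 0") auto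
    have highE: "3 * r + 1 \<in> ?E" if "j < r" "r \<le> m" for r
      using high[of r] that t3 by (cases "r = m") auto
    have nt: "1 \<le> n" "n \<le> 3 * m" "n \<notin> C" using n t3 by auto
    \<comment> \<open>A non-centre \<open>3 * q\<close> lies beyond block \<open>j\<close> and is
      served from its right. A non-centre \<open>3 * q + 1\<close> is served from its left, unless
      that link is cut; then the middle of block \<open>j\<close> serves it. A non-centre
      \<open>3 * q + 2\<close> lies outside block \<open>j\<close> and is served by the neighbour on
      the side away from or towards the cut according as \<open>q\<close> exceeds \<open>j\<close>
      or not: \<open>3 * q + 1\<close> if \<open>j < q\<close>, and \<open>3 * (q + 1)\<close> if
      \<open>q < j\<close>.\<close>
    consider "n = 3 * q" | "n = 3 * q + 1" | "n = 3 * q + 2" using nq by blast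
    then show "\<exists>c\<in>?E. (c + 1 = n \<and> c \<noteq> i) \<or> (c = n + 1 \<and> n \<noteq> i)"
    proof cases
      case 1
      have "j < q" using low[of q] nt 1 by (cases "q \<le> j") auto
      show ?thesis
      proof (cases "n = i")
        case True
        then show ?thesis using \<open>j < q\<close> 1 ij by linarith
      next
        case False
        then show ?thesis using highE[of q] \<open>j < q\<close> 1 nt by (intro bexI[of _ "3 * q + 1"]) auto
      qed
    next
      case 2
      have "q \<le> j" using high[of q] nt 2 by (cases "q \<le> j") auto
      show ?thesis
      proof (cases "i = 3 * q")
        case True
        then have "j = q" unfolding j_def by simp
        moreover have "q < m" using nt 2 by linarith
        ultimately show ?thesis using mid True 2 by (intro bexI[of _ "3 * j + 2"]) auto
      next
        case False
        then show ?thesis using lowE[of q] \<open>q \<le> j\<close> 2 by (intro bexI[of _ "3 * q"]) auto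
      qed
    next
      case 3
      have "q < m" using nt 3 by linarith
      then have "q \<noteq> j" using mid nt 3 by auto
      then consider "q < j" | "j < q" by linarith
      then show ?thesis
      proof cases
        case a: 1
        then have "n < i" using 3 ij by linarith
        then show ?thesis using lowE[of "q + 1"] a 3 by (intro bexI[of _ "3 * (q + 1)"]) auto
      next
        case b: 2
        then have "i < 3 * q + 1" using ij by linarith
        then show ?thesis using highE[of q] b 3 \<open>q < m\<close> by (intro bexI[of _ "3 * q + 1"]) auto
      qed
    qed
  qed
  then show ?thesis by blast
qed

text \<open>These are the middles of the blocks of three, so the path part of the packing is as
  large as a set of centres.\<close>

lemma card_mod_3_eq_2:
  fixes t :: nat
  assumes "t = 1 \<or> t mod 3 = 0"
  shows "card {n \<in> {1..t}. n mod 3 = 2} = t div 3"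
proof -
  define m where "m = t div 3"
  have t: "t = 3 * m \<or> t = 1 \<and> m = 0" using assms by (auto simp: m_def)
  have "{n \<in> {1..t}. n mod 3 = 2} = (\<lambda>r. 3 * r + 2) ` {..<m}"
  proof (intro subset_antisym subsetI)
    fix n assume n: "n \<in> {n \<in> {1..t}. n mod 3 = 2}"
    then have eq: "n = 3 * (n div 3) + 2" using div_mult_mod_eq[of n 3] by simp
    then have "n div 3 < m" using n t by auto
    with eq show "n \<in> (\<lambda>r. 3 * r + 2) ` {..<m}" by blast
  next
    fix n assume "n \<in> (\<lambda>r. 3 * r + 2) ` {..<m}"
    then obtain r where "r < m" "n = 3 * r + 2" by blast
    moreover from this have "n mod 3 = 2" using mod_mult_self2[of 2 3 r] by simp
    ultimately show "n \<in> {n \<in> {1..t}. n mod 3 = 2}" using t by auto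
  qed
  then show ?thesis by (simp add: card_image inj_on_def m_def)
qed


section \<open>Hairy graphs joined by a path\<close>

text \<open>The disjoint union of the two hairy graphs has vertices \<open>V\<close> and arcs \<open>A\<close>, and \<open>S\<close> is the set
  of its support vertices. The connecting path is indexed so that \<open>y 0\<close> and \<open>y (t + 1)\<close> are its
  attachment points.\<close>

locale hairy_path =
  fixes V S :: "'a set" and A :: "'a rel" and y :: "nat \<Rightarrow> 'a" and t :: nat and G :: "'a pair_pre_digraph"
  assumes fin: "finite V" and S_V: "S \<subseteq> V" and A_V: "A \<subseteq> V \<times> V"
    and sym: "sym A" and loopfree: "(a, a) \<notin> A"
    and leaf_nbr: "l \<in> V - S \<Longrightarrow> \<exists>s\<in>S. (s, l) \<in> A"
    and leaf_nbr_unique: "l \<in> V - S \<Longrightarrow> (a, l) \<in> A \<Longrightarrow> (b, l) \<in> A \<Longrightarrow> a = b"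
    and has_leaf: "s \<in> S \<Longrightarrow> \<exists>l\<in>V - S. (s, l) \<in> A"
    and support_nbr: "s \<in> S \<Longrightarrow> \<exists>s'\<in>S. (s', s) \<in> A"
    and y_inj: "inj_on y {0..t + 1}" and y_ends: "y 0 \<in> S" "y (t + 1) \<in> S"
    and y_V: "y ` {1..t} \<inter> V = {}"
    and t: "t = 1 \<or> t mod 3 = 0"
    and pverts_G: "pverts G = V \<union> y ` {1..t}"
    and parcs_G: "parcs G = A \<union> {(y i, y (i + 1)) |i. i \<le> t}\<^sup>s"
begin

section \<open>Adjacency in the joined graph\<close>

lemma in_parcs_G: "(p, q) \<in> parcs G \<longleftrightarrow>
    (p, q) \<in> A \<or> (\<exists>i\<le>t. (p = y i \<and> q = y (i + 1)) \<or> (q = y i \<and> p = y (i + 1)))"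
  unfolding parcs_G symcl_def by force

lemma y_eq_iff: "i \<le> t + 1 \<Longrightarrow> j \<le> t + 1 \<Longrightarrow> y i = y j \<longleftrightarrow> i = j"
  using y_inj by (auto simp: inj_on_def)

lemma y_notin_V: "n \<in> {1..t} \<Longrightarrow> y n \<notin> V"
  using y_V by blast

lemma y_in_V: "i \<le> t + 1 \<Longrightarrow> y i \<in> V \<Longrightarrow> i = 0 \<or> i = t + 1"
  using y_notin_V[of i] by force

lemma y_in_V_S: "i \<le> t + 1 \<Longrightarrow> y i \<in> V \<Longrightarrow> y i \<in> S"
  using y_in_V[of i] y_ends by auto

lemma finite_pverts_G: "finite (pverts G)"
  using fin by (simp add: pverts_G)

lemma sym_G: "(p, q) \<in> parcs G \<Longrightarrow> (q, p) \<in> parcs G"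
  using symD[OF sym] unfolding in_parcs_G by blast

lemma parcs_G_neq: "(p, q) \<in> parcs G \<Longrightarrow> p \<noteq> q"
  using loopfree by (auto simp: in_parcs_G y_eq_iff)

text \<open>The path is attached at support vertices only, so leaves gain no neighbours.\<close>

lemma leaf_arc_G: "l \<in> V - S \<Longrightarrow> (p, l) \<in> parcs G \<longleftrightarrow> (p, l) \<in> A"
proof -
  assume "l \<in> V - S"
  then have "l \<noteq> y i" if "i \<le> t + 1" for i using that y_in_V_S by blast
  then have "l \<noteq> y i" "l \<noteq> y (i + 1)" if "i \<le> t" for i using that by auto
  then show ?thesis unfolding in_parcs_G by blast
qed

lemma path_arc_G:
  assumes "n \<in> {1..t}"
  shows "(p, y n) \<in> parcs G \<longleftrightarrow> p = y (n - 1) \<or> p = y (n + 1)"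
proof -
  have "(p, y n) \<notin> A" using A_V y_notin_V[OF assms] by blast
  then have iff: "(p, y n) \<in> parcs G \<longleftrightarrow>
      (\<exists>i\<le>t. (p = y i \<and> y n = y (i + 1)) \<or> (y n = y i \<and> p = y (i + 1)))"
    unfolding in_parcs_G by blast
  show ?thesis
  proof
    assume "(p, y n) \<in> parcs G"
    then obtain i where i: "i \<le> t" "(p = y i \<and> y n = y (i + 1)) \<or> (y n = y i \<and> p = y (i + 1))"
      unfolding iff by blast
    then show "p = y (n - 1) \<or> p = y (n + 1)"
      using assms y_eq_iff[of n i] y_eq_iff[of n "i + 1"] by auto
  next
    assume "p = y (n - 1) \<or> p = y (n + 1)"
    then show "(p, y n) \<in> parcs G"
    proof
      assume "p = y (n - 1)"
      moreover have "n - 1 \<le> t" "y n = y (n - 1 + 1)" using assms by auto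
      ultimately show ?thesis unfolding iff by blast
    next
      assume "p = y (n + 1)"
      moreover have "n \<le> t" using assms by simp
      ultimately show ?thesis unfolding iff by blast
    qed
  qed
qed

text \<open>\<open>G'\<close> stands for \<open>G\<close> with an edge deleted. Vertices of
  \<open>V\<close> are dominated from \<open>D\<close> alone, so \<open>V\<close> and the path can
  be checked separately.\<close>

lemma dominating_setI:
  assumes "D \<subseteq> V" "C \<subseteq> {1..t}" "pverts G' = pverts G"
    and "\<And>w. w \<in> V - D \<Longrightarrow> \<exists>d\<in>D. (d, w) \<in> parcs G'"
    and "\<And>n. n \<in> {1..t} - C \<Longrightarrow> \<exists>d\<in>D \<union> y ` C. (d, y n) \<in> parcs G'"
  shows "dominating_set G' (D \<union> y ` C)" and "card (D \<union> y ` C) = card D + card C"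
proof -
  show "dominating_set G' (D \<union> y ` C)"
    unfolding dominating_set_def
  proof (intro conjI ballI)
    show "D \<union> y ` C \<subseteq> pverts G'" using assms(1-3) by (auto simp: pverts_G)
    fix w assume "w \<in> pverts G' - (D \<union> y ` C)"
    then consider "w \<in> V - D" | n where "n \<in> {1..t} - C" "w = y n"
      using assms(3) unfolding pverts_G by blast
    then show "\<exists>d\<in>D \<union> y ` C. (d, w) \<in> parcs G'" using assms(4,5) by cases blast+
  qed
  have "C \<subseteq> {0..t + 1}" using assms(2) by auto
  then have "inj_on y C" by (rule inj_on_subset[OF y_inj])
  moreover have "D \<inter> y ` C = {}" using assms(1,2) y_notin_V by blast
  moreover have "finite D" "finite C" using assms fin by (auto intro: finite_subset)
  ultimately show "card (D \<union> y ` C) = card D + card C"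
    by (simp add: card_Un_disjoint card_image)
qed

definition centres :: "nat \<Rightarrow> nat set" where
  "centres i = (SOME C. path_centres t i C)"

lemma centres:
  assumes "i \<le> t"
  shows "centres i \<subseteq> {1..t}" "card (centres i) = t div 3"
    "i \<in> insert 0 (insert (t + 1) (centres i)) \<or> i + 1 \<in> insert 0 (insert (t + 1) (centres i))"
    "n \<in> {1..t} - centres i \<Longrightarrow> \<exists>c\<in>insert 0 (insert (t + 1) (centres i)).
       (c + 1 = n \<and> c \<noteq> i) \<or> (c = n + 1 \<and> n \<noteq> i)"
proof -
  note C = someI_ex[OF ex_path_centres[OF t assms], folded centres_def, unfolded path_centres_def]
  show "centres i \<subseteq> {1..t}" by (rule C[THEN conjunct1])
  note C = C[THEN conjunct2]
  show "card (centres i) = t div 3" by (rule C[THEN conjunct1])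
  note C = C[THEN conjunct2]
  show "i \<in> insert 0 (insert (t + 1) (centres i)) \<or> i + 1 \<in> insert 0 (insert (t + 1) (centres i))"
    by (rule C[THEN conjunct1])
  show "n \<in> {1..t} - centres i \<Longrightarrow> \<exists>c\<in>insert 0 (insert (t + 1) (centres i)).
       (c + 1 = n \<and> c \<noteq> i) \<or> (c = n + 1 \<and> n \<noteq> i)"
    by (rule C[THEN conjunct2, THEN bspec])
qed

text \<open>When the cut is the first (last) link, the end \<open>y 0\<close> (\<open>y (t + 1)\<close>) is not used.\<close>

lemma centres_dominate:
  assumes "i \<le> t" "n \<in> {1..t} - centres i"
    and "i \<noteq> 0 \<Longrightarrow> y 0 \<in> D" "i \<noteq> t \<Longrightarrow> y (t + 1) \<in> D"
  shows "\<exists>d\<in>D \<union> y ` centres i. (d, y n) \<in> parcs G - {(y i, y (i + 1)), (y (i + 1), y i)}"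
proof -
  obtain c where c: "c \<in> insert 0 (insert (t + 1) (centres i))"
      "(c + 1 = n \<and> c \<noteq> i) \<or> (c = n + 1 \<and> n \<noteq> i)"
    using centres(4)[OF assms(1,2)] by blast
  have ct: "c \<le> t + 1" using c assms centres(1)[OF assms(1)] by auto
  \<comment> \<open>\<open>c = 0\<close> forces \<open>n = 1\<close> and
    \<open>i \<noteq> 0\<close>; \<open>c = t + 1\<close> forces \<open>n = t\<close> and
    \<open>i \<noteq> t\<close>. So an end is used only where it is assumed to be in
    \<open>D\<close>.\<close>
  have "y c \<in> D \<union> y ` centres i" using c assms by auto
  moreover have "(y c, y n) \<in> parcs G" using c(2) assms path_arc_G[of n "y c"] by auto
  moreover have "(y c, y n) \<notin> {(y i, y (i + 1)), (y (i + 1), y i)}"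
    using c(2) ct assms by (auto simp: y_eq_iff)
  ultimately show ?thesis by blast
qed

text \<open>The closed neighbourhood of a chosen leaf is the leaf with its support vertex. Those of
  the chosen path vertices avoid \<open>V\<close>, and their indices differ by at least 3. The
  choice \<open>f\<close> of leaves stays free for use at support vertices with several
  leaves.\<close>

lemma packing_G:
  assumes "\<forall>s\<in>S. f s \<in> V - S \<and> (s, f s) \<in> A"
  shows "packing G (f ` S \<union> y ` {n \<in> {1..t}. n mod 3 = 2})"
    and "card (f ` S \<union> y ` {n \<in> {1..t}. n mod 3 = 2}) = card S + t div 3"
proof -
  let ?N = "{n \<in> {1..t}. n mod 3 = 2}"
  have f_nbhd: "closed_nbhd G (f s) = {f s, s}" if "s \<in> S" for s
    using bspec[OF assms that] leaf_nbr_unique leaf_arc_G by (auto simp: closed_nbhd_def)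
  have f_inj: "f s \<noteq> f s'" if "s \<in> S" "s' \<in> S" "s \<noteq> s'" for s s'
    using bspec[OF assms that(1)] bspec[OF assms that(2)] leaf_nbr_unique[of "f s" s s'] that(3) by auto
  \<comment> \<open>\<open>n mod 3 = 2\<close> rules out \<open>n = 1\<close>, and also
    \<open>n = t\<close> since \<open>t\<close> is 1 or a multiple of 3; hence neither attachment
    point is reached.\<close>
  have y_nbhd: "closed_nbhd G (y n) = y ` {n - 1, n, n + 1}" "1 \<le> n - 1" "n + 1 \<le> t" if "n \<in> ?N" for n
  proof -
    show "closed_nbhd G (y n) = y ` {n - 1, n, n + 1}"
      using that path_arc_G[of n] by (auto simp: closed_nbhd_def)
    show "1 \<le> n - 1" using that by (cases "n = 1") auto
    show "n + 1 \<le> t" using that t by (cases "n = t") auto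
  qed
  have y_nbhd_V: "closed_nbhd G (y n) \<inter> V = {}" if "n \<in> ?N" for n
  proof -
    have "closed_nbhd G (y n) \<subseteq> y ` {1..t}"
      unfolding y_nbhd(1)[OF that] using y_nbhd(2,3)[OF that] that by (intro image_mono) auto
    then show ?thesis using y_V by blast
  qed
  have f_nbhd_V: "closed_nbhd G (f s) \<subseteq> V" if "s \<in> S" for s
    using f_nbhd[OF that] bspec[OF assms that] S_V that by auto
  have y_disj: "closed_nbhd G (y n) \<inter> closed_nbhd G (y k) = {}"
    if "n \<in> ?N" "k \<in> ?N" "n \<noteq> k" for n k
  proof -
    have "{n - 1, n, n + 1} \<inter> {k - 1, k, k + 1} = {}"
    proof -
      have "n = 3 * (n div 3) + 2" "k = 3 * (k div 3) + 2"
        using that mult_div_mod_eq[of 3 n] mult_div_mod_eq[of 3 k] by auto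
      moreover from this have "n div 3 < k div 3 \<or> k div 3 < n div 3" using \<open>n \<noteq> k\<close> by linarith
      ultimately have "n + 3 \<le> k \<or> k + 3 \<le> n" by linarith
      then show ?thesis by auto
    qed
    moreover have "{n - 1, n, n + 1} \<subseteq> {0..t + 1}" "{k - 1, k, k + 1} \<subseteq> {0..t + 1}"
      using that by auto
    ultimately show ?thesis
      unfolding y_nbhd(1)[OF that(1)] y_nbhd(1)[OF that(2)] using inj_on_image_Int[OF y_inj]
      by (metis image_empty)
  qed
  have f_disj: "closed_nbhd G (f s) \<inter> closed_nbhd G (f s') = {}"
    if "s \<in> S" "s' \<in> S" "s \<noteq> s'" for s s'
    using f_nbhd[OF that(1)] f_nbhd[OF that(2)] f_inj[OF that] bspec[OF assms that(1)] bspec[OF assms that(2)] that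
    by auto
  show "packing G (f ` S \<union> y ` ?N)"
    unfolding packing_def disjoint_family_on_def
  proof (intro conjI ballI impI)
    show "f ` S \<union> y ` ?N \<subseteq> pverts G" using assms by (auto simp: pverts_G)
    fix p q assume "p \<in> f ` S \<union> y ` ?N" "q \<in> f ` S \<union> y ` ?N" "p \<noteq> q"
    then show "closed_nbhd G p \<inter> closed_nbhd G q = {}"
      using f_disj y_disj f_nbhd_V y_nbhd_V by (elim UnE imageE) (simp, blast+)+
  qed
  have "inj_on f S" using f_inj by (auto simp: inj_on_def)
  moreover have "inj_on y ?N" using y_inj by (rule inj_on_subset) auto
  moreover have "f ` S \<inter> y ` ?N = {}"
  proof -
    have "f ` S \<subseteq> V" using assms by auto
    then show ?thesis using y_V by blast
  qed
  moreover have "finite S" using fin S_V finite_subset by blast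
  ultimately show "card (f ` S \<union> y ` ?N) = card S + t div 3"
    using card_mod_3_eq_2[OF t] by (simp add: card_Un_disjoint card_image)
qed

section \<open>The edges of the joined graph, kind by kind\<close>

abbreviation SR_edge :: "'a \<Rightarrow> 'a \<Rightarrow> bool" where
  "SR_edge a b \<equiv>
     domination_number (delete_edge G (a, b)) = domination_number (subdivide_edge G (a, b))"

text \<open>The packing with one leaf per support vertex survives the deletion, so only
  \<open>D\<close> has to be given. This serves every kind of edge except a leaf edge at a support
  vertex with several leaves.\<close>

lemma SR_edgeI:
  assumes "(a, b) \<in> parcs G" "dominating_set (delete_edge G (a, b)) D" "a \<in> D \<or> b \<in> D"
    and "card D = card S + t div 3"
  shows "SR_edge a b"
proof -
  obtain f where f: "\<forall>s\<in>S. f s \<in> V - S \<and> (s, f s) \<in> A" using has_leaf by metis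
  note P = packing_G[OF f]
  show ?thesis
    by (rule delete_subdivide_domination_eqI[OF finite_pverts_G assms(2,3) packing_delete_edge[OF P(1)]
          packing_not_adjacent[OF P(1) assms(1) parcs_G_neq[OF assms(1)]]])
      (rule trans[OF assms(4) P(2)[symmetric]])
qed

lemma S_dominates_V: "w \<in> V - S \<Longrightarrow> \<exists>d\<in>S. (d, w) \<in> A"
  using leaf_nbr by blast

text \<open>An end of a path edge that lies in \<open>V\<close> is a support vertex, so each leaf
  keeps its neighbour in \<open>S\<close>; the centres for the cut \<open>i\<close> handle the
  path.\<close>

lemma SR_edge_path:
  assumes i: "i \<le> t"
  shows "SR_edge (y i) (y (i + 1))"
proof (rule SR_edgeI)
  show "(y i, y (i + 1)) \<in> parcs G" using i by (auto simp: in_parcs_G)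
  have not_A: "(d, w) \<notin> {(y i, y (i + 1)), (y (i + 1), y i)}" if "(d, w) \<in> A" "w \<in> V - S" for d w
    using that y_in_V_S[of i] y_in_V_S[of "i + 1"] i by auto
  have 1: "\<exists>d\<in>S. (d, w) \<in> parcs (delete_edge G (y i, y (i + 1)))" if "w \<in> V - S" for w
    using S_dominates_V[OF that] not_A that by (auto simp: in_parcs_G)
  have 2: "\<exists>d\<in>S \<union> y ` centres i. (d, y n) \<in> parcs (delete_edge G (y i, y (i + 1)))"
    if "n \<in> {1..t} - centres i" for n
    using centres_dominate[OF i that, of S] y_ends by simp
  note D = dominating_setI[OF S_V centres(1)[OF i] pverts_delete_edge 1 2]
  show "dominating_set (delete_edge G (y i, y (i + 1))) (S \<union> y ` centres i)" by (rule D(1))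
  show "card (S \<union> y ` centres i) = card S + t div 3" using D(2) centres(2)[OF i] by simp
  show "y i \<in> S \<union> y ` centres i \<or> y (i + 1) \<in> S \<union> y ` centres i"
    using centres(3)[OF i] y_ends by auto
qed

text \<open>Here the path is intact. Centres for a fictitious cut are still useful: with
  \<open>i = 0\<close> or \<open>i = t\<close> they do without one of the ends.\<close>

lemma path_centres_dominate_delete:
  assumes "(a, b) \<in> A" "i \<le> t" "n \<in> {1..t} - centres i"
    and "i \<noteq> 0 \<Longrightarrow> y 0 \<in> D" "i \<noteq> t \<Longrightarrow> y (t + 1) \<in> D"
  shows "\<exists>d\<in>D \<union> y ` centres i. (d, y n) \<in> parcs (delete_edge G (a, b))"
proof -
  have "y n \<notin> V" using assms y_notin_V by blast
  then have "y n \<noteq> a" "y n \<noteq> b" using A_V assms(1) by auto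
  then show ?thesis using centres_dominate[OF assms(2-5)] by auto
qed

text \<open>\<open>S\<close> dominates the leaves along leaf edges, all of which remain. The path is
  intact and both its ends are in \<open>S\<close>, so the cut index \<open>0\<close> is merely a
  choice.\<close>

lemma SR_edge_support:
  assumes "(a, b) \<in> A" "a \<in> S" "b \<in> S"
  shows "SR_edge a b"
proof (rule SR_edgeI)
  show "(a, b) \<in> parcs G" using assms by (simp add: in_parcs_G)
  have 1: "\<exists>d\<in>S. (d, w) \<in> parcs (delete_edge G (a, b))" if "w \<in> V - S" for w
    using S_dominates_V[OF that] that assms by (auto simp: in_parcs_G)
  have 2: "\<exists>d\<in>S \<union> y ` centres 0. (d, y n) \<in> parcs (delete_edge G (a, b))"
    if "n \<in> {1..t} - centres 0" for n
    using path_centres_dominate_delete[OF assms(1) _ that, of S] y_ends by simp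
  note D = dominating_setI[OF S_V centres(1)[of 0] pverts_delete_edge 1 2]
  show "dominating_set (delete_edge G (a, b)) (S \<union> y ` centres 0)" by (rule D(1)) simp_all
  show "card (S \<union> y ` centres 0) = card S + t div 3" using D(2) centres(2)[of 0] by simp
  show "a \<in> S \<union> y ` centres 0 \<or> b \<in> S \<union> y ` centres 0" using assms by auto
qed

lemma SR_edge_single_leaf:
  assumes sl: "(s, l) \<in> A" "s \<in> S" "l \<in> V - S"
    and single: "\<And>l'. l' \<in> V - S \<Longrightarrow> (s, l') \<in> A \<Longrightarrow> l' = l"
  shows "SR_edge s l"
proof (rule SR_edgeI)
  show "(s, l) \<in> parcs G" using sl by (simp add: in_parcs_G)
  define D where "D = insert l (S - {s})"
  \<comment> \<open>If \<open>s\<close> is an end of the path, it is missing from \<open>D\<close>;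
    the fictitious cut is placed at that end.\<close>
  define i where "i = (if s = y 0 then 0 else t)"
  have i: "i \<le> t" by (simp add: i_def)
  have ends: "i \<noteq> 0 \<Longrightarrow> y 0 \<in> D" "i \<noteq> t \<Longrightarrow> y (t + 1) \<in> D"
    using y_ends y_eq_iff[of 0 "t + 1"] by (auto simp: i_def D_def split: if_splits)
  have "\<exists>d\<in>D. (d, w) \<in> A - {(s, l), (l, s)}" if w: "w \<in> V - D" for w
  proof (cases "w = s")
    case True
    obtain s' where "s' \<in> S" "(s', s) \<in> A" using support_nbr sl(2) by blast
    moreover have "s' \<noteq> s" using calculation loopfree by auto
    ultimately show ?thesis using True sl by (intro bexI[of _ s']) (auto simp: D_def)
  next
    case False
    then have "w \<in> V - S" "w \<noteq> l" using w by (auto simp: D_def)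
    moreover obtain d where "d \<in> S" "(d, w) \<in> A" using S_dominates_V calculation by blast
    moreover have "d \<noteq> s" using calculation single by blast
    ultimately show ?thesis using False by (intro bexI[of _ d]) (auto simp: D_def)
  qed
  note dominated = this
  have 1: "\<exists>d\<in>D. (d, w) \<in> parcs (delete_edge G (s, l))" if w: "w \<in> V - D" for w
  proof -
    obtain d where "d \<in> D" "(d, w) \<in> A - {(s, l), (l, s)}" using dominated[OF w] by blast
    moreover from this have "(d, w) \<in> parcs (delete_edge G (s, l))" by (simp add: in_parcs_G)
    ultimately show ?thesis by blast
  qed
  have 2: "\<exists>d\<in>D \<union> y ` centres i. (d, y n) \<in> parcs (delete_edge G (s, l))"
    if "n \<in> {1..t} - centres i" for n
    by (rule path_centres_dominate_delete[OF sl(1) i that ends])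
  have "D \<subseteq> V" using sl S_V by (auto simp: D_def)
  note D = dominating_setI[OF this centres(1)[OF i] pverts_delete_edge 1 2]
  show "dominating_set (delete_edge G (s, l)) (D \<union> y ` centres i)" by (rule D(1))
  have "finite S" using fin S_V finite_subset by blast
  then have "card D = card S" using sl card_Suc_Diff1[of S s] by (simp add: D_def)
  then show "card (D \<union> y ` centres i) = card S + t div 3" using D(2) centres(2)[OF i] by simp
  show "s \<in> D \<union> y ` centres i \<or> l \<in> D \<union> y ` centres i" by (simp add: D_def)
qed

text \<open>Exchanging \<open>s\<close> for \<open>l\<close> would leave \<open>l'\<close>
  undominated. Instead \<open>l\<close>, isolated by the deletion, raises the sizes of both
  \<open>D\<close> and the packing by one.\<close>

lemma SR_edge_several_leaves:
  assumes sl: "(s, l) \<in> A" "s \<in> S" "l \<in> V - S"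
    and l': "l' \<in> V - S" "(s, l') \<in> A" "l' \<noteq> l"
  shows "SR_edge s l"
proof -
  let ?G = "delete_edge G (s, l)"
  define D where "D = insert l S"
  have 1: "\<exists>d\<in>D. (d, w) \<in> parcs ?G" if w: "w \<in> V - D" for w
    using S_dominates_V[of w] w sl by (auto simp: in_parcs_G D_def)
  have 2: "\<exists>d\<in>D \<union> y ` centres 0. (d, y n) \<in> parcs ?G" if "n \<in> {1..t} - centres 0" for n
    using path_centres_dominate_delete[OF sl(1) _ that, of D] y_ends by (simp add: D_def)
  have "D \<subseteq> V" using sl S_V by (auto simp: D_def)
  note D = dominating_setI[OF this centres(1)[of 0] pverts_delete_edge 1 2]
  have "finite S" using fin S_V finite_subset by blast
  then have cardD: "card (D \<union> y ` centres 0) = Suc (card S + t div 3)"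
    using D(2) centres(2)[of 0] sl by (simp add: D_def)
  obtain f0 where f0: "\<And>s. s \<in> S \<Longrightarrow> f0 s \<in> V - S \<and> (s, f0 s) \<in> A" using has_leaf by metis
  \<comment> \<open>Representing \<open>s\<close> by \<open>l'\<close> keeps \<open>l\<close> out of
    the packing, so that it can be added.\<close>
  define f where "f = f0(s := l')"
  have f: "\<forall>r\<in>S. f r \<in> V - S \<and> (r, f r) \<in> A" using f0 l' by (simp add: f_def)
  define P where "P = f ` S \<union> y ` {n \<in> {1..t}. n mod 3 = 2}"
  note P = packing_G[OF f, folded P_def]
  have "l \<notin> f ` S"
  proof
    assume "l \<in> f ` S"
    then obtain r where r: "r \<in> S" "l = f r" by blast
    then have "r = s" using f leaf_nbr_unique[OF sl(3) _ sl(1)] by blast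
    then show False using r l' by (simp add: f_def)
  qed
  then have lP: "l \<notin> P" using y_notin_V sl(3) by (auto simp: P_def)
  \<comment> \<open>\<open>packing_not_adjacent\<close> does not apply to \<open>insert l P\<close>,
    which is no packing of \<open>G\<close>: \<open>l\<close> and \<open>l'\<close> share the
    neighbour \<open>s\<close>.\<close>
  have sP: "s \<notin> P" using f y_notin_V sl(2) S_V by (auto simp: P_def)
  have finP: "finite P" using \<open>finite S\<close> by (simp add: P_def)
  have iso: "(z, l) \<notin> parcs ?G" for z
    using leaf_arc_G[OF sl(3)] leaf_nbr_unique[OF sl(3) _ sl(1)] by auto
  then have iso': "(l, z) \<notin> parcs ?G" for z using sym_G[of l z] by auto
  have lG: "l \<in> pverts ?G" using sl by (simp add: pverts_G)
  show ?thesis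
  proof (rule delete_subdivide_domination_eqI[OF finite_pverts_G])
    show "dominating_set ?G (D \<union> y ` centres 0)" by (rule D(1)) simp_all
    show "s \<in> D \<union> y ` centres 0 \<or> l \<in> D \<union> y ` centres 0" by (simp add: D_def)
    show "packing ?G (insert l P)"
      by (rule packing_insert_isolated[OF packing_delete_edge[OF P(1)] lG iso iso'])
    show "\<not> (s \<in> insert l P \<and> l \<in> insert l P)" using sP sl by auto
    show "card (D \<union> y ` centres 0) = card (insert l P)"
      using cardD P(2) lP finP by simp
  qed
qed

lemma SR_edge_A:
  assumes "(a, b) \<in> A" "a \<in> S"
  shows "SR_edge a b"
  using SR_edge_support SR_edge_single_leaf[of a b] SR_edge_several_leaves[of a b] assms A_V
  by blast

lemma SR_edge_commute: "SR_edge a b \<Longrightarrow> SR_edge b a"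
  by (simp add: delete_edge_commute[of G b] subdivide_edge_commute[of G b])

lemma SR_edge:
  assumes "e \<in> parcs G"
  shows "domination_number (delete_edge G e) = domination_number (subdivide_edge G e)"
proof -
  obtain a b where e: "e = (a, b)" by fastforce
  consider "(a, b) \<in> A" "a \<in> S" | "(a, b) \<in> A" "a \<in> V - S"
    | i where "i \<le> t" "(a = y i \<and> b = y (i + 1)) \<or> (b = y i \<and> a = y (i + 1))"
    using assms A_V unfolding e in_parcs_G by blast
  then show ?thesis unfolding e
  proof cases
    case 1
    then show "SR_edge a b" by (rule SR_edge_A)
  next
    case 2
    have "(b, a) \<in> A" using 2 sym by (auto dest: symD)
    \<comment> \<open>\<open>a\<close> is a leaf, and its only neighbour is a support
      vertex.\<close>
    moreover have "b \<in> S" using 2 calculation leaf_nbr leaf_nbr_unique by blast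
    ultimately show "SR_edge a b" by (intro SR_edge_commute[OF SR_edge_A])
  next
    case 3
    then show "SR_edge a b" using SR_edge_path SR_edge_commute by blast
  qed
qed

lemma pair_graph_G: "pair_graph G"
proof (rule pair_graph.intro)
  have wf: "fst e \<in> pverts G \<and> snd e \<in> pverts G" if "e \<in> parcs G" for e
  proof -
    have "y i \<in> pverts G" if "i \<le> t + 1" for i
      using that y_ends S_V by (cases "i = 0 \<or> i = t + 1") (auto simp: pverts_G)
    then have "y i \<in> pverts G" "y (i + 1) \<in> pverts G" if "i \<le> t" for i using that by auto
    moreover have "A \<subseteq> pverts G \<times> pverts G" using A_V by (auto simp: pverts_G)
    moreover obtain p q where e: "e = (p, q)" by (cases e)
    ultimately show ?thesis using that unfolding e in_parcs_G fst_conv snd_conv by blast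
  qed
  have "finite (parcs G)"
    using wf finite_pverts_G by (intro finite_subset[of "parcs G" "pverts G \<times> pverts G"]) force+
  then show "pair_digraph G" "pair_pseudo_graph G"
    using wf finite_pverts_G parcs_G_neq sym_G
    by unfold_locales (auto simp: symmetric_def intro: symI)
qed

end

section \<open>Connectedness and the structure of hairy graphs\<close>

lemma pair_graph_connected_iff:
  assumes "pair_graph G"
  shows "Digraph_Component.connected (with_proj G) \<longleftrightarrow>
    pverts G \<noteq> {} \<and> (\<forall>a\<in>pverts G. \<forall>b\<in>pverts G. (a, b) \<in> (parcs G)\<^sup>*)"
proof -
  interpret pair_graph G by fact
  have "(parcs G)\<^sup>s = parcs G" by (auto simp: symcl_def intro: arcs_symmetric)
  moreover have "(a, b) \<in> rtrancl_on (pverts G) (parcs G) \<longleftrightarrow> (a, b) \<in> (parcs G)\<^sup>*"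
    if "a \<in> pverts G" for a b
    using reachable_conv'[OF that, of b] by (simp add: reachable_def)
  ultimately show ?thesis unfolding connected_conv by simp
qed

lemma leaf_unique_nbr:
  assumes "leaf G l" "(l, a) \<in> parcs G" "(l, b) \<in> parcs G"
  shows "a = b"
proof -
  have "card {e \<in> parcs G. fst e = l} = 1"
    using assms(1) by (simp add: leaf_def out_degree_def out_arcs_def)
  then obtain e where e: "{e \<in> parcs G. fst e = l} = {e}" by (rule card_1_singletonE)
  have "(l, a) \<in> {e \<in> parcs G. fst e = l}" "(l, b) \<in> {e \<in> parcs G. fst e = l}"
    using assms by simp_all
  then show ?thesis unfolding e by blast
qed

text \<open>If all neighbours of \<open>w\<close> were leaves, the graph would be a star centred at \<open>w\<close>.\<close>

lemma ex_nonleaf_nbr: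
  assumes "pair_graph H" "Digraph_Component.connected (with_proj H)" "domination_number H \<ge> 2"
    and w: "w \<in> pverts H"
  shows "\<exists>z. (w, z) \<in> parcs H \<and> \<not> leaf H z"
proof (rule ccontr)
  interpret pair_graph H by fact
  assume "\<nexists>z. (w, z) \<in> parcs H \<and> \<not> leaf H z"
  then have leaves: "leaf H z" if "(w, z) \<in> parcs H" for z using that by blast
  \<comment> \<open>A walk that has moved from \<open>w\<close> to a neighbour stands on a leaf and
    can only return to \<open>w\<close>.\<close>
  have "b = w \<or> (w, b) \<in> parcs H" if "(w, b) \<in> (parcs H)\<^sup>*" for b
    using that
  proof induction
    case (step b c)
    then show ?case
    proof (elim disjE)
      assume "(w, b) \<in> parcs H"
      then have "c = w" using leaf_unique_nbr[OF leaves step(2)] arcs_symmetric by blast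
      then show ?thesis by simp
    qed simp
  qed simp
  then have "dominating_set H {w}"
    using assms pair_graph_connected_iff[of H] by (auto simp: dominating_set_def)
  then have "domination_number H \<le> 1" using domination_number_le[of H "{w}"] pair_finite_verts by simp
  then show False using assms(3) by simp
qed

text \<open>Domination number at least 2 excludes adjacent leaves, so the support vertices are
  exactly the non-leaves; this yields the conditions on \<open>S\<close> in the locale.\<close>

lemma hairy_support_structure:
  assumes H: "pair_graph H" "Digraph_Component.connected (with_proj H)" "hairy H" "domination_number H \<ge> 2"
  shows "support_vertex H s \<Longrightarrow> \<not> leaf H s"
    and "l \<in> pverts H \<Longrightarrow> \<exists>s. \<not> leaf H s \<and> (s, l) \<in> parcs H"
    and "s \<in> pverts H \<Longrightarrow> \<not> leaf H s \<Longrightarrow> \<exists>l. leaf H l \<and> (s, l) \<in> parcs H"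
proof -
  interpret pair_graph H by fact
  show "\<not> leaf H s" if s: "support_vertex H s"
  proof -
    obtain l where l: "leaf H l" "(s, l) \<in> parcs H" using s by (auto simp: support_vertex_def)
    then have "l \<in> pverts H" by (simp add: leaf_def)
    then obtain z where "(l, z) \<in> parcs H" "\<not> leaf H z" using ex_nonleaf_nbr[OF H(1,2,4)] by blast
    then show ?thesis using leaf_unique_nbr l arcs_symmetric by metis
  qed
  show "\<exists>s. \<not> leaf H s \<and> (s, l) \<in> parcs H" if "l \<in> pverts H"
    using ex_nonleaf_nbr[OF H(1,2,4) that] arcs_symmetric by blast
  show "\<exists>l. leaf H l \<and> (s, l) \<in> parcs H" if "s \<in> pverts H" "\<not> leaf H s"
    using H(3) that by (auto simp: hairy_def support_vertex_def)
qed

section \<open>Instantiating the locale and connectedness of the joined graph\<close>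

theorem theorem7:
  fixes H1 H2 :: "'a pair_pre_digraph" and u v :: 'a and t :: nat and x :: "nat \<Rightarrow> 'a"
  assumes "pair_graph H1" and "Digraph_Component.connected (with_proj H1)" and "hairy H1"
    and "pair_graph H2" and "Digraph_Component.connected (with_proj H2)" and "hairy H2"
    and "pverts H1 \<inter> pverts H2 = {}"
    and "domination_number H1 \<ge> 2" and "domination_number H2 \<ge> 2"
    and "support_vertex H1 u" and "support_vertex H2 v"
    and "t \<ge> 1"
    and "inj_on x {1..t}" and "x ` {1..t} \<inter> (pverts H1 \<union> pverts H2) = {}"
    and "t = 1 \<or> t mod 3 = 0"
  shows "SR_graph (path_join H1 u H2 v t x)"
proof -
  interpret H1: pair_graph H1 by fact
  interpret H2: pair_graph H2 by fact
  define G where "G = path_join H1 u H2 v t x"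
  \<comment> \<open>\<open>x\<close> is unconstrained at \<open>0\<close> and \<open>t + 1\<close>;
    putting \<open>u\<close> and \<open>v\<close> there gives all connecting edges the same
    form.\<close>
  define y where "y i = (if i = 0 then u else if i = t + 1 then v else x i)" for i
  define S where "S = {s \<in> pverts H1. \<not> leaf H1 s} \<union> {s \<in> pverts H2. \<not> leaf H2 s}"
  note st1 = hairy_support_structure[OF assms(1,2,3,8)]
  note st2 = hairy_support_structure[OF assms(4,5,6,9)]
  have uv: "u \<in> pverts H1" "v \<in> pverts H2" "\<not> leaf H1 u" "\<not> leaf H2 v"
    using assms(10,11) st1(1) st2(1) by (auto simp: support_vertex_def)
  have y_x: "y ` {1..t} = x ` {1..t}" by (rule image_cong) (auto simp: y_def)
  have y_arcs: "{(u, x 1)} \<union> {(x i, x (i + 1)) |i. 1 \<le> i \<and> i < t} \<union> {(x t, v)} =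
      {(y i, y (i + 1)) |i. i \<le> t}" (is "?L = ?R")
  proof (intro subset_antisym subsetI)
    fix e assume "e \<in> ?L"
    then consider "e = (u, x 1)" | i where "1 \<le> i" "i < t" "e = (x i, x (i + 1))" | "e = (x t, v)"
      by blast
    then show "e \<in> ?R"
    proof cases
      case 1
      then have "e = (y 0, y (0 + 1))" using assms(12) by (simp add: y_def)
      then show ?thesis by blast
    next
      case (2 i)
      then have "e = (y i, y (i + 1))" by (simp add: y_def)
      then show ?thesis using 2 by (intro CollectI exI[of _ i]) simp
    next
      case 3
      then have "e = (y t, y (t + 1))" using assms(12) by (simp add: y_def)
      then show ?thesis by blast
    qed
  next
    fix e assume "e \<in> ?R"
    then obtain i where "i \<le> t" "e = (y i, y (i + 1))" by blast
    then show "e \<in> ?L"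
      using assms(12) by (cases "i = 0"; cases "i = t") (auto simp: y_def)
  qed
  interpret hairy_path "pverts H1 \<union> pverts H2" S "parcs H1 \<union> parcs H2" y t G
  proof
    show "finite (pverts H1 \<union> pverts H2)" using H1.pair_finite_verts H2.pair_finite_verts by simp
    show "S \<subseteq> pverts H1 \<union> pverts H2" by (auto simp: S_def)
    show "parcs H1 \<union> parcs H2 \<subseteq> (pverts H1 \<union> pverts H2) \<times> (pverts H1 \<union> pverts H2)"
      using H1.wellformed' H2.wellformed' by auto
    show "sym (parcs H1 \<union> parcs H2)"
      using H1.arcs_symmetric H2.arcs_symmetric by (auto intro: symI)
    show "(a, a) \<notin> parcs H1 \<union> parcs H2" for a using H1.no_loops' H2.no_loops' by auto
    show "\<exists>s\<in>S. (s, l) \<in> parcs H1 \<union> parcs H2" if "l \<in> pverts H1 \<union> pverts H2 - S" for l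
      using that st1(2)[of l] st2(2)[of l] H1.in_arcsD1 H2.in_arcsD1 unfolding S_def by blast
    show "a = b" if "l \<in> pverts H1 \<union> pverts H2 - S" "(a, l) \<in> parcs H1 \<union> parcs H2"
      "(b, l) \<in> parcs H1 \<union> parcs H2" for l a b
    proof (cases "l \<in> pverts H1")
      case True
      then have "leaf H1 l" "(a, l) \<in> parcs H1" "(b, l) \<in> parcs H1"
        using that assms(7) H2.in_arcsD2 by (auto simp: S_def)
      then show ?thesis using leaf_unique_nbr H1.arcs_symmetric by metis
    next
      case False
      then have "leaf H2 l" "(a, l) \<in> parcs H2" "(b, l) \<in> parcs H2"
        using that H1.in_arcsD2 by (auto simp: S_def)
      then show ?thesis using leaf_unique_nbr H2.arcs_symmetric by metis
    qed
    show "\<exists>l\<in>pverts H1 \<union> pverts H2 - S. (s, l) \<in> parcs H1 \<union> parcs H2" if "s \<in> S" for s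
    proof (cases "s \<in> pverts H1")
      case True
      then have "\<not> leaf H1 s" using that assms(7) by (auto simp: S_def)
      then obtain l where "leaf H1 l" "(s, l) \<in> parcs H1" using st1(3)[OF True] by blast
      then show ?thesis using assms(7) H1.in_arcsD2 by (intro bexI[of _ l]) (auto simp: S_def)
    next
      case False
      then have "s \<in> pverts H2" "\<not> leaf H2 s" using that by (auto simp: S_def)
      then obtain l where "leaf H2 l" "(s, l) \<in> parcs H2" using st2(3) by blast
      then show ?thesis using assms(7) H2.in_arcsD2 by (intro bexI[of _ l]) (auto simp: S_def)
    qed
    show "\<exists>s'\<in>S. (s', s) \<in> parcs H1 \<union> parcs H2" if "s \<in> S" for s
      using that st1(2)[of s] st2(2)[of s] H1.in_arcsD1 H2.in_arcsD1 unfolding S_def by blast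
    show "inj_on y {0..t + 1}"
    proof (rule inj_onI)
      have nx: "x i \<noteq> u" "x i \<noteq> v" if "i \<in> {1..t}" for i
        using that assms(14) uv(1,2) by blast+
      have "u \<noteq> v" using uv assms(7) by auto
      fix i j assume "i \<in> {0..t + 1}" "j \<in> {0..t + 1}" "y i = y j"
      moreover have "i = j" if "x i = x j" "i \<in> {1..t}" "j \<in> {1..t}"
        using inj_onD[OF assms(13) that] .
      ultimately show "i = j"
        using nx[of i] nx[of j] \<open>u \<noteq> v\<close> by (auto simp: y_def split: if_splits)
    qed
    show "y 0 \<in> S" "y (t + 1) \<in> S" using uv by (auto simp: y_def S_def)
    show "y ` {1..t} \<inter> (pverts H1 \<union> pverts H2) = {}" unfolding y_x by (rule assms(14))
    show "t = 1 \<or> t mod 3 = 0" by fact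
    show "pverts G = pverts H1 \<union> pverts H2 \<union> y ` {1..t}"
      unfolding y_x by (simp add: G_def path_join_def)
    show "parcs G = parcs H1 \<union> parcs H2 \<union> {(y i, y (i + 1)) |i. i \<le> t}\<^sup>s"
      unfolding y_arcs[symmetric] by (simp add: G_def path_join_def)
  qed
  \<comment> \<open>Every vertex is reached from \<open>u\<close>: within \<open>H1\<close>, along
    the path, or along the whole path to \<open>v\<close> and on within \<open>H2\<close>.\<close>
  have mono: "(parcs H1)\<^sup>* \<subseteq> (parcs G)\<^sup>*" "(parcs H2)\<^sup>* \<subseteq> (parcs G)\<^sup>*"
    by (intro rtrancl_mono; simp add: parcs_G le_supI1)+
  have path: "(u, y i) \<in> (parcs G)\<^sup>*" if "i \<le> t + 1" for i
    using that
  proof (induction i)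
    case 0
    then show ?case by (simp add: y_def)
  next
    case (Suc i)
    then have "(y i, y (Suc i)) \<in> parcs G" by (auto simp: in_parcs_G)
    then show ?case using Suc by (auto intro: rtrancl_into_rtrancl)
  qed
  have from_u: "(u, w) \<in> (parcs G)\<^sup>*" if "w \<in> pverts G" for w
  proof -
    consider "w \<in> pverts H1" | "w \<in> pverts H2" | i where "i \<in> {1..t}" "w = y i"
      using \<open>w \<in> pverts G\<close> unfolding pverts_G by blast
    then show ?thesis
    proof cases
      case 1
      then have "(u, w) \<in> (parcs H1)\<^sup>*" using assms(2) uv(1) by (simp add: pair_graph_connected_iff[OF assms(1)])
      then show ?thesis using mono(1) by blast
    next
      case 2
      then have "(v, w) \<in> (parcs H2)\<^sup>*" using assms(5) uv(2) by (simp add: pair_graph_connected_iff[OF assms(4)])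
      then have "(v, w) \<in> (parcs G)\<^sup>*" using mono(2) by blast
      moreover have "(u, v) \<in> (parcs G)\<^sup>*" using path[of "t + 1"] by (simp add: y_def)
      ultimately show ?thesis by (rule rtrancl_trans[rotated])
    next
      case 3
      then show ?thesis using path[of i] by simp
    qed
  qed
  have "sym ((parcs G)\<^sup>*)" using sym_G by (intro sym_rtrancl symI)
  then have "(a, b) \<in> (parcs G)\<^sup>*" if "a \<in> pverts G" "b \<in> pverts G" for a b
    using from_u[OF that(1)] from_u[OF that(2)] by (meson rtrancl_trans symD)
  moreover have uvG: "{u, v} \<subseteq> pverts G" using uv by (simp add: pverts_G)
  ultimately have "Digraph_Component.connected (with_proj G)"
    unfolding pair_graph_connected_iff[OF pair_graph_G] by blast
  moreover have "2 \<le> card (pverts G)"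
  proof -
    have "u \<noteq> v" using uv assms(7) by auto
    then show ?thesis using card_mono[OF finite_pverts_G uvG] by simp
  qed
  ultimately show ?thesis
    using pair_graph_G SR_edge unfolding SR_graph_def G_def by blast
qed

end
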